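(* For every integer $d\geq 3$, there exist positive integers $a,b,k_2$ and nonnegative integers $k_1,k_3$ with $k_1+k_2+k_3+2=d$ such that the lecture hall simplex $P_d^{(1^{k_1},a,1^{k_2},b,1^{k_3})}$ is not Ehrhart positive.
   Context: For a sequence $s=(s_1,\ldots,s_d)$ of positive integers, the $d$-dimensional $s$-lecture hall simplex is the lattice simplex $$P_d^{s}=\left\{x\in\mathbb{R}^d : 0\leq\frac{x_1}{s_1}\leq\frac{x_2}{s_2}\leq\cdots\leq\frac{x_d}{s_d}\leq 1\right\}.$$ The notation $(1^{k_1},a,1^{k_2},b,1^{k_3})$ denotes the vector $(\underbrace{1,\ldots,1}_{k_1},a,\underbrace{1,\ldots,1}_{k_2},b,\underbrace{1,\ldots,1}_{k_3})$. For a $d$-dimensional lattice polytope $P\subset\mathbb{R}^n$ and $t\in\mathbb{Z}_{\geq 0}$, let $tP=\{tp : p\in P\}$ and $i(P;t)=|tP\cap\mathbb{Z}^n|$; this is a polynomial in $t$ of degree $d$ (the Ehrhart polynomial). $P$ is Ehrhart positive if all coefficients (of $t^0,\dots,t^d$) of $i(P;t)$ are positive (strictly greater than $0$). *)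

theory Defs
  imports "Jordan_Normal_Form.Matrix" "HOL-Computational_Algebra.Polynomial"
begin

(* R^n is carrier_vec n, so coordinates are indexed from 0. *)

definition integer_lattice :: "nat \<Rightarrow> real vec set" where
  "integer_lattice n = {x \<in> carrier_vec n. \<forall>i<n. x $ i \<in> \<int>}"

definition dilate :: "nat \<Rightarrow> real vec set \<Rightarrow> real vec set" where
  "dilate t P = (\<lambda>p. real t \<cdot>\<^sub>v p) ` P"

definition lattice_point_count :: "nat \<Rightarrow> real vec set \<Rightarrow> nat \<Rightarrow> nat" where
  "lattice_point_count n P t = card (dilate t P \<inter> integer_lattice n)"

(* Meaningful for lattice polytopes P in R^n, for which such a polynomial exists by
   Ehrhart's theorem; it is unique by the lemma below. *)
definition ehrhart_poly :: "nat \<Rightarrow> real vec set \<Rightarrow> real poly" where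
  "ehrhart_poly n P = (THE p. \<forall>t::nat. poly p (real t) = real (lattice_point_count n P t))"

lemma ehrhart_poly_eqI:
  assumes "\<And>t::nat. poly p (real t) = real (lattice_point_count n P t)"
  shows "ehrhart_poly n P = p"
  unfolding ehrhart_poly_def
proof (rule the_equality)
  fix q :: "real poly"
  assume q: "\<forall>t::nat. poly q (real t) = real (lattice_point_count n P t)"
  show "q = p"
  proof (rule ccontr)
    assume "q \<noteq> p"
    then have "finite {x. poly (q - p) x = 0}"
      by (intro poly_roots_finite) simp
    moreover have "range real \<subseteq> {x. poly (q - p) x = 0}"
      using q assms by auto
    ultimately have "finite (range real)"
      by (rule finite_subset[rotated])
    then show False
      using finite_imageD[of real UNIV] by (simp add: inj_on_def)
  qed
qed (use assms in simp)

(* The degree of the Ehrhart polynomial is the dimension of P, so the coefficients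
   in question are those of t^0, ..., t^(dim P). *)
definition ehrhart_positive :: "nat \<Rightarrow> real vec set \<Rightarrow> bool" where
  "ehrhart_positive n P \<longleftrightarrow>
     (\<forall>i \<le> degree (ehrhart_poly n P). coeff (ehrhart_poly n P) i > 0)"

(* The list being sorted is the chain 0 <= x_1/s_1 <= ... <= x_d/s_d <= 1, d = length s. *)
definition lecture_hall_simplex :: "nat list \<Rightarrow> real vec set" where
  "lecture_hall_simplex s =
     {x \<in> carrier_vec (length s).
        sorted (0 # map (\<lambda>i. x $ i / real (s ! i)) [0..<length s] @ [1])}"

end

theory Submission imports Defs begin

text \<open>
  The witness is \<open>s = (a, 1, b, 1\<^sup>k)\<close> with \<open>k = d - 3\<close>. At a lattice point
  the ratio \<open>x_i / s_i\<close> is an integer wherever \<open>s_i = 1\<close>, so fixing such a coordinate cuts the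
  chain of inequalities into independent pieces with integral bounds.
  For \<open>k = 0\<close>, fixing the middle coordinate \<open>y\<close> leaves \<open>a y + 1\<close> choices
  before it and \<open>b (t - y) + 1\<close> choices after it, and summing over \<open>y \<le> t\<close> gives
  \<open>a b (t + 1 choose 3) + (a + b) (t + 1 choose 2) + (t + 1)\<close>
  (lemma \<open>card_lecture_hall_points_base\<close>). Appending an entry \<open>1\<close> to \<open>s\<close> replaces the
  counting function by its partial sums, which by the hockey-stick identity raises both
  arguments of each binomial coefficient by one. Hence the count is
  \<open>a b (t + k + 1 choose k + 3) + (a + b) (t + k + 1 choose k + 2) + (t + k + 1 choose k + 1)\<close>
  (lemma \<open>card_lecture_hall_points\<close>).

  As a polynomial in \<open>t\<close>, the first binomial coefficient is
  \<open>(t - 1) t (t + 1) \<cdots> (t + k + 1) / (k + 3)!\<close>. The factor \<open>t - 1\<close> makes its linear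
  coefficient negative, namely \<open>- 1 / ((k + 2) (k + 3))\<close>, and the second one has linear
  coefficient \<open>1 / (k + 2)\<close>. The linear coefficient of the Ehrhart polynomial is therefore
  \<open>- a b / ((k + 2) (k + 3)) + (a + b) / (k + 2) + c\<close> with \<open>c\<close> depending on \<open>k\<close> only. Once
  \<open>a > k + 3\<close> is fixed, this is a decreasing affine function of \<open>b\<close>, so it is negative for
  all large \<open>b\<close>.
\<close>

section \<open>Lattice points of dilated lecture hall simplices\<close>

definition lecture_hall_points :: "nat list \<Rightarrow> nat \<Rightarrow> nat list set" where
  "lecture_hall_points s t =
     {xs. length xs = length s \<and>
          sorted (0 # map2 (\<lambda>x m. real x / real m) xs s @ [real t])}"

text \<open>
  The case \<open>t = 0\<close> is separate because scaling by \<open>0\<close> cannot be undone: there, positivity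
  of \<open>s\<close> squeezes the chain to the origin.
\<close>
lemma dilate_lecture_hall_simplex:
  assumes pos: "\<forall>m\<in>set s. m > 0"
  shows "dilate t (lecture_hall_simplex s) =
     {x \<in> carrier_vec (length s).
        sorted (0 # map (\<lambda>i. x $ i / real (s ! i)) [0..<length s] @ [real t])}" (is "_ = ?R")
proof (cases "t = 0")
  case True
  have origin: "sorted (0 # map (\<lambda>i. 0\<^sub>v (length s) $ i / real (s ! i)) [0..<length s] @ [real u])"
    for u
  proof -
    have "map (\<lambda>i. 0\<^sub>v (length s) $ i / real (s ! i)) [0..<length s] = replicate (length s) 0"
      by (intro nth_equalityI) auto
    then show ?thesis by (simp add: sorted_append del: map_eq_conv)
  qed
  have "?R = {0\<^sub>v (length s)}"
  proof (intro equalityI subsetI)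
    fix x assume x: "x \<in> ?R"
    have "x $ i = 0" if "i < length s" for i
    proof -
      have "x $ i / real (s ! i) = 0"
        by (rule antisym) (use x True that in \<open>auto simp: sorted_append\<close>)
      moreover have "s ! i > 0" using pos that by auto
      ultimately show ?thesis by simp
    qed
    then show "x \<in> {0\<^sub>v (length s)}" using x by (auto intro!: eq_vecI)
  qed (use True origin[of 0] in auto)
  moreover have "dilate 0 (lecture_hall_simplex s) = {0\<^sub>v (length s)}"
  proof -
    have "0\<^sub>v (length s) \<in> lecture_hall_simplex s"
      using origin[of 1] by (auto simp: lecture_hall_simplex_def)
    moreover have "0 \<cdot>\<^sub>v p = 0\<^sub>v (length s)" if "p \<in> lecture_hall_simplex s" for p :: "real vec"
      using that by (auto simp: lecture_hall_simplex_def intro!: eq_vecI)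
    ultimately show ?thesis unfolding dilate_def by force
  qed
  ultimately show ?thesis using True by simp
next
  case False
  then have t: "real t > 0" by simp
  have mono: "sorted (0 # map (\<lambda>i. (c * x i) / real (s ! i)) [0..<length s] @ [c * u])"
    if "sorted (0 # map (\<lambda>i. x i / real (s ! i)) [0..<length s] @ [u])" and "c > 0"
    for c u :: real and x :: "nat \<Rightarrow> real"
  proof -
    have "sorted (map ((*) c) (0 # map (\<lambda>i. x i / real (s ! i)) [0..<length s] @ [u]))"
      unfolding sorted_map
      by (rule sorted_wrt_mono_rel[OF _ that(1)]) (use that(2) in auto)
    then show ?thesis by (simp add: comp_def)
  qed
  show ?thesis
  proof (intro equalityI subsetI)
    fix x assume "x \<in> dilate t (lecture_hall_simplex s)"
    then obtain p where p: "p \<in> lecture_hall_simplex s" "x = real t \<cdot>\<^sub>v p"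
      by (auto simp: dilate_def)
    have "map (\<lambda>i. (real t * p $ i) / real (s ! i)) [0..<length s] =
          map (\<lambda>i. x $ i / real (s ! i)) [0..<length s]"
      using p by (auto simp: lecture_hall_simplex_def)
    then show "x \<in> ?R" using p mono[of "\<lambda>i. p $ i" 1 "real t"] t
      by (auto simp: lecture_hall_simplex_def simp del: map_eq_conv)
  next
    fix x assume x: "x \<in> ?R"
    define p where "p = inverse (real t) \<cdot>\<^sub>v x"
    have "map (\<lambda>i. (inverse (real t) * x $ i) / real (s ! i)) [0..<length s] =
          map (\<lambda>i. p $ i / real (s ! i)) [0..<length s]"
      using x by (auto simp: p_def)
    then have "p \<in> lecture_hall_simplex s"
      using x t mono[of "\<lambda>i. x $ i" "real t" "inverse (real t)"]
      by (auto simp: lecture_hall_simplex_def p_def simp del: map_eq_conv)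
    moreover have "x = real t \<cdot>\<^sub>v p" using t by (simp add: p_def smult_smult_assoc)
    ultimately show "x \<in> dilate t (lecture_hall_simplex s)" by (auto simp: dilate_def)
  qed
qed

lemma lattice_point_count_lecture_hall_simplex:
  assumes pos: "\<forall>m\<in>set s. m > 0"
  shows "lattice_point_count (length s) (lecture_hall_simplex s) t = card (lecture_hall_points s t)"
proof -
  let ?f = "\<lambda>xs. vec_of_list (map real xs)"
  have chain: "map (\<lambda>i. ?f xs $ i / real (s ! i)) [0..<length s] =
      map2 (\<lambda>x m. real x / real m) xs s" if "length xs = length s" for xs :: "nat list"
    using that by (intro nth_equalityI) (auto simp: vec_of_list_index)
  have "dilate t (lecture_hall_simplex s) \<inter> integer_lattice (length s) =
      ?f ` lecture_hall_points s t" (is "?L = _")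
  proof (intro equalityI subsetI)
    fix x assume x: "x \<in> ?L"
    define xs where "xs = map (\<lambda>i. nat \<lfloor>x $ i\<rfloor>) [0..<length s]"
    have "?f xs = x"
    proof (rule eq_vecI)
      fix i assume "i < dim_vec x"
      then have i: "i < length s" using x by (auto simp: integer_lattice_def)
      have "x $ i / real (s ! i) \<ge> 0"
        using x i by (auto simp: dilate_lecture_hall_simplex[OF pos])
      moreover have "s ! i > 0" using pos i by auto
      ultimately have "x $ i \<ge> 0" by (simp add: zero_le_divide_iff)
      moreover have "x $ i \<in> \<int>" using x i by (auto simp: integer_lattice_def)
      ultimately show "?f xs $ i = x $ i"
        using i by (auto simp: xs_def vec_of_list_index elim!: Ints_cases)
    qed (use x in \<open>auto simp: xs_def integer_lattice_def\<close>)
    moreover have "length xs = length s" by (simp add: xs_def)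
    ultimately have "xs \<in> lecture_hall_points s t"
      using x chain[of xs] by (auto simp: lecture_hall_points_def dilate_lecture_hall_simplex[OF pos])
    with \<open>?f xs = x\<close> show "x \<in> ?f ` lecture_hall_points s t" by blast
  next
    fix x assume "x \<in> ?f ` lecture_hall_points s t"
    then obtain xs where xs: "xs \<in> lecture_hall_points s t" "x = ?f xs" by auto
    then have len: "length xs = length s" by (simp add: lecture_hall_points_def)
    then have "x \<in> carrier_vec (length s)" using xs(2) by (simp add: carrier_vecI)
    then show "x \<in> ?L"
      using xs chain[OF len] len
      by (auto simp: lecture_hall_points_def integer_lattice_def vec_of_list_index
          dilate_lecture_hall_simplex[OF pos])
  qed
  moreover have "inj_on ?f (lecture_hall_points s t)"
  proof (rule inj_onI)
    fix xs ys assume "?f xs = ?f ys"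
    then have "map real xs = map real ys" by (metis list_vec)
    then show "xs = ys" by (simp add: inj_on_def map_inj_on)
  qed
  ultimately show ?thesis by (simp add: lattice_point_count_def card_image)
qed

section \<open>Counting for \<open>(a, 1, b, 1\<^sup>k)\<close>\<close>

text \<open>
  Because the appended entry is \<open>1\<close>, the new last coordinate \<open>y\<close> is itself the upper bound of
  the remaining chain, which is thus a chain of the same kind with \<open>y\<close> in place of \<open>t\<close>.
\<close>
lemma lecture_hall_points_append_one:
  "lecture_hall_points (s @ [1]) t =
     (\<lambda>(y, xs). xs @ [y]) ` (SIGMA y:{..t}. lecture_hall_points s y)" (is "?L = ?R")
proof (intro equalityI subsetI)
  fix zs assume zs: "zs \<in> ?L"
  then obtain xs y where *: "zs = xs @ [y]" "length xs = length s"
    by (cases zs rule: rev_cases) (auto simp: lecture_hall_points_def)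
  with zs have "y \<le> t" "xs \<in> lecture_hall_points s y"
    by (auto simp: lecture_hall_points_def sorted_append)
  with * show "zs \<in> ?R" by force
next
  fix zs assume "zs \<in> ?R"
  then show "zs \<in> ?L" by (force simp: lecture_hall_points_def sorted_append)
qed

lemma card_lecture_hall_points_append_one:
  assumes "\<And>y. finite (lecture_hall_points s y)"
  shows "finite (lecture_hall_points (s @ [1]) t)"
    and "card (lecture_hall_points (s @ [1]) t) = (\<Sum>y\<le>t. card (lecture_hall_points s y))"
  unfolding lecture_hall_points_append_one
  by (auto simp: assms card_image inj_on_def)

lemma lecture_hall_points_base:
  assumes "a > 0" "b > 0"
  shows "lecture_hall_points [a, 1, b] t =
     (\<lambda>(y, x, z). [x, y, z]) ` (SIGMA y:{..t}. {..a * y} \<times> {b * y..b * t})" (is "?L = ?R")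
proof (intro equalityI subsetI)
  have chain: "[x, y, z] \<in> ?L \<longleftrightarrow> x \<le> a * y \<and> b * y \<le> z \<and> z \<le> b * t \<and> y \<le> t" for x y z
  proof -
    have "real x / real a \<le> real y \<longleftrightarrow> x \<le> a * y"
      using assms by (simp add: divide_le_eq mult.commute flip: of_nat_mult)
    moreover have "real y \<le> real z / real b \<longleftrightarrow> b * y \<le> z"
      using assms by (simp add: le_divide_eq mult.commute flip: of_nat_mult)
    moreover have "real z / real b \<le> real t \<longleftrightarrow> z \<le> b * t"
      using assms by (simp add: divide_le_eq mult.commute flip: of_nat_mult)
    moreover have "y \<le> t" if "b * y \<le> z" "z \<le> b * t"
      using le_trans[OF that] assms by simp
    ultimately show ?thesis
      unfolding lecture_hall_points_def by (auto intro: order_trans)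
  qed
  show "v \<in> ?R" if v_in: "v \<in> ?L" for v
  proof -
    obtain x y z where v: "v = [x, y, z]"
      using v_in by (auto simp: lecture_hall_points_def numeral_3_eq_3 length_Suc_conv)
    show ?thesis using v_in unfolding v chain by force
  qed
  show "v \<in> ?L" if "v \<in> ?R" for v
    using that chain by auto
qed

text \<open>
  The three binomial coefficients that occur below, as polynomials in \<open>t\<close> with the common
  factor \<open>(t + 1) \<cdots> (t + k + 1)\<close>.
\<close>
lemma binomial_common_factor:
  fixes t k :: nat
  defines "q \<equiv> pochhammer (1 + real t) (k + 1)"
  shows "real ((t + k + 1) choose (k + 1)) = q / fact (k + 1)"
    and "real ((t + k + 1) choose (k + 2)) = real t * q / fact (k + 2)"
    and "real ((t + k + 1) choose (k + 3)) = (real t - 1) * real t * q / fact (k + 3)"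
proof -
  have P: "pochhammer (real t) (Suc n) = real t * pochhammer (1 + real t) n"
    "pochhammer (real t - 1) (Suc n) = (real t - 1) * pochhammer (real t) n" for n
    by (simp_all add: pochhammer_rec add.commute)
  show "real ((t + k + 1) choose (k + 1)) = q / fact (k + 1)"
    unfolding binomial_gbinomial gbinomial_pochhammer' q_def by (simp add: add.commute)
  have "real (t + k + 1) - real (k + 2) + 1 = real t" by simp
  then show "real ((t + k + 1) choose (k + 2)) = real t * q / fact (k + 2)"
    unfolding binomial_gbinomial gbinomial_pochhammer' q_def
    using P(1)[of "k + 1"] by simp
  have "real (t + k + 1) - real (k + 3) + 1 = real t - 1" by simp
  then show "real ((t + k + 1) choose (k + 3)) = (real t - 1) * real t * q / fact (k + 3)"
    unfolding binomial_gbinomial gbinomial_pochhammer' q_def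
    using P(1)[of "k + 1"] P(2)[of "k + 2"] by (simp add: eval_nat_numeral mult.assoc)
qed

lemma card_lecture_hall_points_base:
  assumes "a > 0" "b > 0"
  shows "finite (lecture_hall_points [a, 1, b] t)"
    and "card (lecture_hall_points [a, 1, b] t) =
           a * b * ((t + 1) choose 3) + (a + b) * ((t + 1) choose 2) + (t + 1)"
proof -
  show "finite (lecture_hall_points [a, 1, b] t)"
    unfolding lecture_hall_points_base[OF assms] by simp
  have "card (lecture_hall_points [a, 1, b] t) =
      (\<Sum>y\<le>t. (a * y + 1) * (Suc (b * t) - b * y))"
    unfolding lecture_hall_points_base[OF assms]
    by (subst card_image) (auto simp: inj_on_def card_cartesian_product)
  then have "real (card (lecture_hall_points [a, 1, b] t)) =
      (\<Sum>y\<le>t. real ((a * y + 1) * (Suc (b * t) - b * y)))" by simp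
  also have "\<dots> = (\<Sum>y\<le>t. (real a * real y + 1) * (real b * (real t - real y) + 1))"
  proof (intro sum.cong refl)
    fix y assume "y \<in> {..t}"
    then have "b * y \<le> Suc (b * t)" by (simp add: le_SucI)
    then have "real (Suc (b * t) - b * y) = real b * (real t - real y) + 1"
      by (subst of_nat_diff) (simp_all add: algebra_simps)
    then show "real ((a * y + 1) * (Suc (b * t) - b * y)) =
        (real a * real y + 1) * (real b * (real t - real y) + 1)"
      by (simp only: of_nat_mult of_nat_add of_nat_1)
  qed
  \<comment> \<open>The sum is generalised to \<open>y \<le> n\<close> so that induction leaves the \<open>t\<close> in the summand fixed.\<close>
  also have "(\<Sum>y\<le>n. (real a * real y + 1) * (real b * (real t - real y) + 1)) =
      real a * real b * (real t * (real n * (real n + 1) / 2)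
        - real n * (real n + 1) * (2 * real n + 1) / 6)
      + real a * (real n * (real n + 1) / 2)
      + real b * ((real n + 1) * real t - real n * (real n + 1) / 2) + (real n + 1)" for n
    by (induction n) (simp_all add: field_simps)
  also have "real a * real b * (real t * (real t * (real t + 1) / 2)
        - real t * (real t + 1) * (2 * real t + 1) / 6)
      + real a * (real t * (real t + 1) / 2)
      + real b * ((real t + 1) * real t - real t * (real t + 1) / 2) + (real t + 1) =
      real a * real b * ((real t - 1) * real t * (1 + real t) / 6)
      + (real a + real b) * (real t * (1 + real t) / 2) + (real t + 1)"
    by (simp add: field_simps)
  also have "\<dots> = real (a * b * ((t + 1) choose 3) + (a + b) * ((t + 1) choose 2) + (t + 1))"
  proof -
    have "real ((t + 1) choose 2) = real t * (1 + real t) / 2"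
      using binomial_common_factor(2)[of t 0] by (simp add: numeral_2_eq_2)
    moreover have "real ((t + 1) choose 3) = (real t - 1) * real t * (1 + real t) / 6"
      using binomial_common_factor(3)[of t 0] by (simp add: fact_numeral)
    ultimately show ?thesis
      by (simp only: of_nat_add of_nat_mult of_nat_1)
  qed
  finally show "card (lecture_hall_points [a, 1, b] t) =
      a * b * ((t + 1) choose 3) + (a + b) * ((t + 1) choose 2) + (t + 1)"
    unfolding of_nat_eq_iff .
qed

text \<open>
  The hockey-stick identity; for \<open>m \<le> r\<close> there is no correction term at the lower end.
\<close>
lemma sum_choose_shifted:
  fixes m r t :: nat
  assumes "m \<le> r"
  shows "(\<Sum>y\<le>t. (y + m) choose r) = (t + m + 1) choose (r + 1)"
proof (induction t)
  case 0
  then show ?case using assms by (cases "m = r") (simp_all add: binomial_eq_0)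
qed simp

lemma card_lecture_hall_points:
  assumes "a > 0" "b > 0"
  shows "finite (lecture_hall_points ([a, 1, b] @ replicate k 1) t) \<and>
         card (lecture_hall_points ([a, 1, b] @ replicate k 1) t) =
           a * b * ((t + k + 1) choose (k + 3)) + (a + b) * ((t + k + 1) choose (k + 2))
             + ((t + k + 1) choose (k + 1))"
proof (induction k arbitrary: t)
  case 0
  show ?case using card_lecture_hall_points_base[OF assms, of t] 
    by (simp add: numeral_2_eq_2 del: binomial_Suc_Suc)
next
  case (Suc k)
  have snoc: "[a, 1, b] @ replicate (Suc k) 1 = ([a, 1, b] @ replicate k 1) @ [1]"
    by (simp add: replicate_append_same)
  have fin: "finite (lecture_hall_points ([a, 1, b] @ replicate k 1) y)" for y
    using Suc.IH by blast
  have "card (lecture_hall_points (([a, 1, b] @ replicate k 1) @ [1]) t) =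
      (\<Sum>y\<le>t. a * b * ((y + (k + 1)) choose (k + 3))
         + (a + b) * ((y + (k + 1)) choose (k + 2)) + ((y + (k + 1)) choose (k + 1)))"
    unfolding card_lecture_hall_points_append_one(2)[OF fin]
    using Suc.IH by (simp add: add.assoc)
  also have "\<dots> = a * b * ((t + (k + 1) + 1) choose (k + 3 + 1))
      + (a + b) * ((t + (k + 1) + 1) choose (k + 2 + 1)) + ((t + (k + 1) + 1) choose (k + 1 + 1))"
    unfolding sum.distrib sum_distrib_left[symmetric]
    by (subst (1 2 3) sum_choose_shifted) simp_all
  finally have "card (lecture_hall_points (([a, 1, b] @ replicate k 1) @ [1]) t) =
      a * b * ((t + Suc k + 1) choose (Suc k + 3)) + (a + b) * ((t + Suc k + 1) choose (Suc k + 2))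
        + ((t + Suc k + 1) choose (Suc k + 1))"
    by (simp add: eval_nat_numeral)
  then show ?case
    unfolding snoc using card_lecture_hall_points_append_one(1)[OF fin] by blast
qed

section \<open>The linear coefficient of the Ehrhart polynomial\<close>

text \<open>
  The rising factorial is taken in the polynomial ring; its value at \<open>t\<close> is
  \<open>(t + 1) \<cdots> (t + k + 1)\<close>, the common factor of the binomial coefficients.
\<close>
lemma ehrhart_poly_lecture_hall_simplex:
  fixes a b k :: nat
  assumes "a > 0" "b > 0"
  shows "ehrhart_poly (k + 3) (lecture_hall_simplex ([a, 1, b] @ replicate k 1)) =
    smult (1 / fact (k + 1)) (pochhammer [:1, 1:] (k + 1))
    + pCons 0 (smult (real (a + b) / fact (k + 2)) (pochhammer [:1, 1:] (k + 1))
      + smult (real (a * b) / fact (k + 3)) ([:-1, 1:] * pochhammer [:1, 1:] (k + 1)))"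
proof (rule ehrhart_poly_eqI)
  fix t :: nat
  have poly_poch: "poly (pochhammer [:1, 1:] n) x = pochhammer (1 + x) n" for n and x :: real
    by (induction n) (simp_all add: pochhammer_Suc of_nat_poly algebra_simps)
  have len: "length ([a, 1, b] @ replicate k 1) = k + 3" by simp
  have "lattice_point_count (length ([a, 1, b] @ replicate k 1))
      (lecture_hall_simplex ([a, 1, b] @ replicate k 1)) t =
      card (lecture_hall_points ([a, 1, b] @ replicate k 1) t)"
    by (rule lattice_point_count_lecture_hall_simplex) (use assms in auto)
  then have "real (lattice_point_count (k + 3)
      (lecture_hall_simplex ([a, 1, b] @ replicate k 1)) t) =
      real (a * b) * real ((t + k + 1) choose (k + 3))
      + real (a + b) * real ((t + k + 1) choose (k + 2)) + real ((t + k + 1) choose (k + 1))"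
    unfolding len using card_lecture_hall_points[OF assms, of k t]
    by (simp add: add.commute del: binomial_Suc_Suc)
  then show "poly (smult (1 / fact (k + 1)) (pochhammer [:1, 1:] (k + 1))
    + pCons 0 (smult (real (a + b) / fact (k + 2)) (pochhammer [:1, 1:] (k + 1))
      + smult (real (a * b) / fact (k + 3)) ([:-1, 1:] * pochhammer [:1, 1:] (k + 1)))) (real t) =
    real (lattice_point_count (k + 3) (lecture_hall_simplex ([a, 1, b] @ replicate k 1)) t)"
    unfolding binomial_common_factor
    by (simp add: poly_poch algebra_simps add_divide_distrib diff_divide_distrib
        del: fact_Suc pochhammer_Suc)
qed

lemma linear_coeff_ehrhart_poly_lecture_hall_simplex:
  fixes a b k :: nat
  assumes "a > 0" "b > 0"
  shows "coeff (ehrhart_poly (k + 3) (lecture_hall_simplex ([a, 1, b] @ replicate k 1))) 1 =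
    coeff (pochhammer [:1, 1:] (k + 1)) 1 / fact (k + 1)
    + (real a + real b) / (real k + 2) - real a * real b / ((real k + 2) * (real k + 3))"
proof -
  have poch0: "coeff (pochhammer [:1, 1:] n) 0 = (fact n :: real)" for n
    by (induction n) (simp_all add: pochhammer_Suc coeff_mult_0 of_nat_poly algebra_simps)
  have f: "fact (k + 2) = (real k + 2) * fact (k + 1)"
    "fact (k + 3) = (real k + 2) * (real k + 3) * fact (k + 1)"
    by (simp_all add: eval_nat_numeral algebra_simps)
  have "fact (k + 1) / fact (k + 2) = 1 / (real k + 2)"
    "fact (k + 1) / fact (k + 3) = 1 / ((real k + 2) * (real k + 3))"
    unfolding f by simp_all
  then have "x * fact (k + 1) / fact (k + 2) = x / (real k + 2)"
    "x * fact (k + 1) / fact (k + 3) = x / ((real k + 2) * (real k + 3))" for x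
    by (metis times_divide_eq_right mult.right_neutral)+
  then show ?thesis
    unfolding ehrhart_poly_lecture_hall_simplex[OF assms]
    using poch0[of "k + 1"]
    by (simp add: coeff_mult_0 coeff_pCons del: fact_Suc)
qed

theorem theorem4p3:
  fixes d :: nat
  assumes "d \<ge> 3"
  shows "\<exists>a b k1 k2 k3 :: nat.
           a > 0 \<and> b > 0 \<and> k2 > 0 \<and> k1 + k2 + k3 + 2 = d \<and>
           \<not> ehrhart_positive d
               (lecture_hall_simplex
                  (replicate k1 1 @ [a] @ replicate k2 1 @ [b] @ replicate k3 1))"
proof -
  define k where "k = d - 3"
  have d: "d = k + 3" using assms by (simp add: k_def)
  define c :: real where "c = coeff (pochhammer [:1, 1:] (k + 1)) 1 / fact (k + 1)"
  \<comment> \<open>For this \<open>a\<close> the linear coefficient is \<open>c + (a - b) / (k + 2)\<close>.\<close>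
  define a where "a = 2 * (k + 3)"
  obtain b0 :: nat where b0: "real a + c * (real k + 2) < real b0"
    using reals_Archimedean2 by blast
  define b where "b = Suc b0"
  have ab: "a > 0" "b > 0" by (simp_all add: a_def b_def)
  let ?P = "lecture_hall_simplex ([a, 1, b] @ replicate k 1)"
  have "real a * real b / ((real k + 2) * (real k + 3)) = 2 * real b / (real k + 2)"
    using add_pos_nonneg[of 3 "real k"]
    by (simp add: a_def divide_simps add_eq_0_iff)
  then have "coeff (ehrhart_poly d ?P) 1 =
      c + (real a + real b) / (real k + 2) - 2 * real b / (real k + 2)"
    unfolding d linear_coeff_ehrhart_poly_lecture_hall_simplex[OF ab] c_def by simp
  also have "\<dots> = (c * (real k + 2) + real a - real b) / (real k + 2)"
    using add_pos_nonneg[of 2 "real k"] by (simp add: add_divide_distrib diff_divide_distrib)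
  also have "\<dots> < 0"
    using b0 by (intro divide_neg_pos) (simp_all add: b_def)
  finally have neg: "coeff (ehrhart_poly d ?P) 1 < 0" .
  then have "1 \<le> degree (ehrhart_poly d ?P)"
    by (intro le_degree) simp
  with neg have "\<not> ehrhart_positive d ?P"
    unfolding ehrhart_positive_def by (metis order_less_asym)
  then have "\<not> ehrhart_positive d
      (lecture_hall_simplex (replicate 0 1 @ [a] @ replicate 1 1 @ [b] @ replicate k 1))"
    by simp
  moreover have "0 + 1 + k + 2 = d" by (simp add: d)
  moreover have "(1 :: nat) > 0" by simp
  ultimately show ?thesis using ab by blast
qed

end
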